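(* Assume $\rho(\partial_0 f)<1$, and let $\tilde p$, $\tilde R$, $D_a(0)$ and the sets $\tilde M_p$ ($p\in\mathbb{N}$) be as defined in the context. Then: (a) $\tilde M_p\subset D_a(0)$ for any $p\geq\tilde p$; (b) $\tilde M_{kp}\subset\tilde M_{(k+1)p}$ for any $k\in\mathbb{N}$ and $p\in\{\tilde p,\tilde p+1,\dots,2\tilde p-1\}$; (c) for any $x\in D_a(0)$ there exists $p^x\geq\tilde p$ such that $x\in\tilde M_{p^x}$.
   Context: Let $\Omega\subset\mathbb{R}^n$ be a domain (open connected set) with $0\in\Omega$, and let $f:\Omega\to\Omega$ be an $\mathbb{R}$-analytic function with $f(0)=0$. Write $f^k$ for the $k$-th iterate of $f$ ($f^0=\mathrm{id}$), $\|\cdot\|$ for the Euclidean norm on $\mathbb{R}^n$ and for the induced operator norm on matrices, $A=\partial_0 f$ for the Jacobian matrix of $f$ at $0$, $\rho(A)$ for its spectral radius, and $B(r)=\{x\in\mathbb{R}^n:\|x\|<r\}$ for $r>0$. Here $\mathbb{N}=\{0,1,2,\dots\}$. The domain of attraction of $0$ is $D_a(0)=\{x\in\Omega: f^k(x)\to 0 \text{ as } k\to\infty\}$. Standing assumption: $\rho(A)<1$. Let $\tilde p\geq 1$ be the smallest positive integer such that $\|A^p\|<1$ for any $p\geq\tilde p$. Let $\tilde R>0$ be the largest number such that $B(\tilde R)\subset\Omega$ and $\|f^p(x)\|<\|x\|$ for all $p\in\{\tilde p,\tilde p+1,\dots,2\tilde p-1\}$ and $x\in B(\tilde R)\setminus\{0\}$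 (some positive radius with this property exists); if every $r>0$ has this property, then $\tilde R=+\infty$ and $B(\tilde R)=\Omega=\mathbb{R}^n$. For an integer $p\geq 0$ put $\tilde M_p=f^{-p}(B(\tilde R))=\{x\in\Omega: f^p(x)\in B(\tilde R)\}$. *)

theory Defs
  imports "HOL-Analysis.Analysis"
begin

text \<open>A multi-index is a function \<open>m :: 'n \<Rightarrow> nat\<close>, and \<open>(x - a)\<^sup>m\<close> is the product of the
  \<open>(x $ i - a $ i) ^ m i\<close>. Since multi-indices carry no canonical order, the power series is
  summed unconditionally (\<open>has_sum\<close>).\<close>

definition real_analytic_on :: "(real ^ 'n \<Rightarrow> real ^ 'm) \<Rightarrow> (real ^ 'n) set \<Rightarrow> bool" where
  "real_analytic_on f \<Omega> \<longleftrightarrow>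
     (\<forall>a\<in>\<Omega>. \<exists>r>0. \<exists>c :: ('n \<Rightarrow> nat) \<Rightarrow> real ^ 'm. ball a r \<subseteq> \<Omega> \<and>
        (\<forall>x\<in>ball a r.
           ((\<lambda>m. (\<Prod>i\<in>UNIV. (x $ i - a $ i) ^ m i) *\<^sub>R c m) has_sum f x) UNIV))"

text \<open>The class operation \<open>^\<close> on \<open>real ^ 'n ^ 'n\<close> is the entrywise power, hence this definition
  of the power with respect to the matrix product.\<close>

primrec matrix_pow :: "real ^ 'n ^ 'n \<Rightarrow> nat \<Rightarrow> real ^ 'n ^ 'n" where
  "matrix_pow A 0 = mat 1"
| "matrix_pow A (Suc k) = A ** matrix_pow A k"

definition matrix_opnorm :: "real ^ 'n ^ 'n \<Rightarrow> real" where
  "matrix_opnorm A = onorm (\<lambda>x. A *v x)"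

text \<open>The eigenvalues of a real matrix are its complex ones.\<close>

definition matrix_spectrum :: "real ^ 'n ^ 'n \<Rightarrow> complex set" where
  "matrix_spectrum A = {l. \<exists>v. v \<noteq> 0 \<and> map_matrix complex_of_real A *v v = l *s v}"

definition matrix_spectral_radius :: "real ^ 'n ^ 'n \<Rightarrow> real" where
  "matrix_spectral_radius A = Max (cmod ` matrix_spectrum A)"

definition domain_of_attraction :: "(real ^ 'n) set \<Rightarrow> (real ^ 'n \<Rightarrow> real ^ 'n) \<Rightarrow> (real ^ 'n) set" where
  "domain_of_attraction \<Omega> f = {x\<in>\<Omega>. (\<lambda>k. (f ^^ k) x) \<longlonglongrightarrow> 0}"

definition p_tilde :: "(real ^ 'n \<Rightarrow> real ^ 'n) \<Rightarrow> nat" where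
  "p_tilde f =
     (LEAST q. 1 \<le> q \<and> (\<forall>p\<ge>q. matrix_opnorm (matrix_pow (jacobian f (at 0)) p) < 1))"

text \<open>Radii are extended reals, so that \<open>zero_ball \<infinity>\<close> is the whole space and the largest admissible
  radius below may be \<open>\<infinity>\<close>.\<close>

definition zero_ball :: "ereal \<Rightarrow> (real ^ 'n) set" where
  "zero_ball r = {x. ereal (norm x) < r}"

definition R_tilde :: "(real ^ 'n) set \<Rightarrow> (real ^ 'n \<Rightarrow> real ^ 'n) \<Rightarrow> ereal" where
  "R_tilde \<Omega> f =
     (GREATEST r. 0 < r \<and> zero_ball r \<subseteq> \<Omega> \<and>
        (\<forall>p\<in>{p_tilde f..2 * p_tilde f - 1}. \<forall>x\<in>zero_ball r - {0}. norm ((f ^^ p) x) < norm x))"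

definition M_tilde :: "(real ^ 'n) set \<Rightarrow> (real ^ 'n \<Rightarrow> real ^ 'n) \<Rightarrow> nat \<Rightarrow> (real ^ 'n) set" where
  "M_tilde \<Omega> f p = {x\<in>\<Omega>. (f ^^ p) x \<in> zero_ball (R_tilde \<Omega> f)}"

end

theory Submission
  imports Defs "HOL-Computational_Algebra.Fundamental_Theorem_Algebra"
begin

text \<open>
  Everything rests on the fact that the iterates \<open>f ^^ p\<close> with \<open>p\<close> in the window
  \<open>{q..2 * q - 1}\<close>, \<open>q = p_tilde f\<close>, strictly decrease the norm on the open ball \<open>B\<close> of radius
  \<open>R_tilde \<Omega> f\<close>, away from \<open>0\<close>. Every \<open>p \<ge> q\<close> is a sum of numbers from this window, so no such
  iterate increases the norm on \<open>B\<close> (\<open>norm_funpow_le\<close>). This gives (b): once an orbit has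
  entered \<open>B\<close> at time \<open>k * p\<close>, it is still in \<open>B\<close> at time \<open>(k + 1) * p\<close>. For (a), a limit point \<open>z\<close>
  of the orbit of \<open>f ^^ q\<close> has the same norm as its image, since both are the limit of the decreasing
  norms; so \<open>z = 0\<close>, and the monotonicity carries the convergence over to all iterates
  (\<open>funpow_tendsto_zero\<close>). For (c), an orbit that tends to \<open>0\<close> eventually lies in \<open>B\<close>, because
  the radius is positive.

  This argument needs three facts about the definitions: \<open>p_tilde f\<close> and \<open>R_tilde \<Omega> f\<close>
  have the properties by which they are defined as a least and as a greatest element, the radius
  is positive, and \<open>f\<close> is continuous.

  For \<open>p_tilde f\<close>, the powers of a matrix \<open>A\<close> of spectral radius less than \<open>1\<close> must tend
  to \<open>0\<close>. Over the complex numbers, some polynomial \<open>p \<noteq> 0\<close> satisfies \<open>p(A) = 0\<close>, because the powers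
  of \<open>A\<close> are linearly dependent. Removing the linear factors of \<open>p\<close> one at a time shows that
  \<open>A\<^sup>k v\<close> tends to \<open>0\<close> for every \<open>v\<close> (\<open>iterates_tendsto_zero_of_annihilator\<close>): a factor whose
  root is not an eigenvalue acts injectively and can be dropped, and a factor with an eigenvalue \<open>z\<close>
  as its root gives the contracting recurrence \<open>A\<^sup>k\<^sup>+\<^sup>1 v = z A\<^sup>k v + A\<^sup>k (A v - z v)\<close>.

  A power series is differentiable at its centre because the terms of degree at least \<open>2\<close> sum to
  \<open>O(\<bar>h\<bar>\<^sup>2)\<close> (\<open>real_analytic_on_imp_differentiable\<close>); applied at every point of \<open>\<Omega>\<close>, this yields
  continuity as well. By the chain rule \<open>f ^^ p\<close> has derivative \<open>A\<^sup>p\<close> at \<open>0\<close>, and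
  \<open>\<parallel>A\<^sup>p\<parallel> < 1\<close> makes it decrease norms near \<open>0\<close>, which provides an admissible radius. The supremum
  of the admissible radii is admissible because its open ball is the union of the admissible balls
  (\<open>R_tilde_works\<close>).
\<close>

section \<open>Powers of a matrix of spectral radius less than one\<close>

text \<open>The vector \<open>p(B) v\<close>, evaluated by Horner's scheme, so that the recursion over \<open>pCons\<close>
  holds also for the zero polynomial.\<close>

definition poly_act :: "complex^'n^'n \<Rightarrow> complex poly \<Rightarrow> complex^'n \<Rightarrow> complex^'n" where
  "poly_act B p v = fold_coeffs (\<lambda>a w. a *s v + B *v w) p 0"

lemma poly_act_0 [simp]: "poly_act B 0 v = 0"
  by (simp add: poly_act_def)

lemma poly_act_pCons [simp]: "poly_act B (pCons a p) v = a *s v + B *v poly_act B p v"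
  by (cases "a = 0 \<and> p = 0") (auto simp: poly_act_def fold_coeffs_def cCons_def)

lemma poly_act_add: "poly_act B (p + q) v = poly_act B p v + poly_act B q v"
  by (induction p q rule: poly_induct2)
     (simp_all add: matrix_vector_right_distrib vector_sadd_rdistrib)

lemma poly_act_smult: "poly_act B (smult c p) v = c *s poly_act B p v"
  by (induction p) (simp_all add: vector_add_ldistrib vector_smult_assoc vector_scalar_commute)

lemma poly_act_sum: "poly_act B (sum p S) v = (\<Sum>i\<in>S. poly_act B (p i) v)"
  by (induction S rule: infinite_finite_induct) (simp_all add: poly_act_add)

lemma poly_act_monom: "poly_act B (monom c i) v = c *s (((*v) B ^^ i) v)"
  by (induction i) (simp_all add: monom_0 monom_Suc vector_scalar_commute)

text \<open>Polynomials in \<open>B\<close> commute with each other. The first equation makes \<open>B v - z v\<close> a vector that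
  is annihilated by a polynomial of smaller degree than \<open>v\<close>; the second shows that \<open>q(B) v\<close>, unless
  it vanishes, is then an eigenvector.\<close>

lemma poly_act_linear_factor:
  "poly_act B q (B *v v - z *s v) = poly_act B ([:- z, 1:] * q) v"
  "poly_act B q (B *v v - z *s v) = B *v poly_act B q v - z *s poly_act B q v"
proof -
  show *: "poly_act B q (B *v v - z *s v) = B *v poly_act B q v - z *s poly_act B q v"
    by (induction q) 
       (simp_all add: matrix_vector_right_distrib matrix_vector_mult_diff_distrib vector_ssub_ldistrib 
         vector_add_ldistrib vector_smult_assoc vector_scalar_commute mult.commute)
  have "[:- z, 1:] * q = smult (- z) q + pCons 0 q"
    by simp
  then have "poly_act B ([:- z, 1:] * q) v = (- z) *s poly_act B q v + B *v poly_act B q v"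
    by (simp only: poly_act_add poly_act_smult poly_act_pCons vector_smult_lzero add_0)
  also have "\<dots> = B *v poly_act B q v - z *s poly_act B q v"
    by (simp add: vec_eq_iff)
  finally show "poly_act B q (B *v v - z *s v) = poly_act B ([:- z, 1:] * q) v"
    using * by simp
qed

lemma poly_act_eigenvector:
  assumes "B *v v = z *s v"
  shows "poly_act B p v = poly p z *s v"
  by (induction p)
     (simp_all add: assms vector_sadd_rdistrib vector_smult_assoc vector_scalar_commute mult.commute)

text \<open>The coefficients are indexed by positions in the sequence and not by its values, so repeated
  values form a case of their own, settled by \<open>X i - X j = 0\<close>.\<close>

lemma linear_dependence_of_sequence:
  fixes X :: "nat \<Rightarrow> 'a::euclidean_space"
  shows "\<exists>N u. (\<exists>i\<le>N. u i \<noteq> 0) \<and> (\<Sum>i\<le>N. u i *\<^sub>R X i) = 0"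
proof (cases "inj_on X {..DIM('a)}")
  case True
  have "dependent (X ` {..DIM('a)})"
    by (rule dependent_biggerset) (simp add: card_image True)
  then obtain w where w: "\<exists>v\<in>X ` {..DIM('a)}. w v \<noteq> 0" "(\<Sum>v\<in>X ` {..DIM('a)}. w v *\<^sub>R v) = 0"
    by (auto simp: real_vector.dependent_finite)
  then have "(\<Sum>i\<le>DIM('a). w (X i) *\<^sub>R X i) = 0"
    by (simp add: sum.reindex[OF True])
  with w(1) show ?thesis
    by (intro exI[of _ "DIM('a)"] exI[of _ "\<lambda>i. w (X i)"]) auto
next
  case False
  then obtain i j where ij: "i \<le> DIM('a)" "j \<le> DIM('a)" "i \<noteq> j" "X i = X j"
    by (auto simp: inj_on_def)
  let ?u = "\<lambda>k. (if k = i then 1 else 0) - (if k = j then 1 else 0) :: real"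
  have "(\<Sum>k\<le>DIM('a). ?u k *\<^sub>R X k) =
        (\<Sum>k\<le>DIM('a). if k = i then X k else 0) - (\<Sum>k\<le>DIM('a). if k = j then X k else 0)"
    unfolding sum_subtractf[symmetric] by (intro sum.cong) auto
  also have "\<dots> = 0"
    using ij by simp
  finally show ?thesis
    using ij by (intro exI[of _ "DIM('a)"] exI[of _ ?u]) auto
qed

text \<open>The dependence is taken among the powers of \<open>B\<close> as matrices and not among the vectors \<open>B\<^sup>i v\<close>.
  The polynomial is then the same for all \<open>v\<close>, and its roots contain all eigenvalues
  (\<open>finite_matrix_spectrum\<close>). Real coefficients suffice, since the complex matrices form
  a real vector space of finite dimension.\<close>

lemma annihilating_polynomial:
  fixes B :: "complex^'n^'n"
  shows "\<exists>p. p \<noteq> 0 \<and> (\<forall>v. poly_act B p v = 0)"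
proof -
  define X where "X i = (((**) B ^^ i) (mat 1))" for i
  have X: "X i *v v = ((*v) B ^^ i) v" for i v
    by (induction i) (simp_all add: X_def matrix_vector_mul_assoc[symmetric])
  obtain N and u :: "nat \<Rightarrow> real"
    where u: "\<exists>i\<le>N. u i \<noteq> 0" "(\<Sum>i\<le>N. u i *\<^sub>R X i) = 0"
    using linear_dependence_of_sequence[of X] by blast
  define p where "p = (\<Sum>i\<le>N. monom (complex_of_real (u i)) i)"
  have "coeff p i = u i" if "i \<le> N" for i
    using that by (simp add: p_def coeff_sum)
  with u(1) have "p \<noteq> 0"
    by (metis coeff_0 of_real_eq_0_iff)
  moreover have "poly_act B p v = 0" for v
  proof -
    have lin: "linear (\<lambda>M. M *v v)" for v :: "complex^'n"
      by (rule linearI)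
        (simp_all add: vec_eq_iff matrix_vector_mult_def scaleR_sum_right sum.distrib distrib_right)
    have scale: "complex_of_real a *s w = a *\<^sub>R w" for a and w :: "complex^'n"
      by (simp add: vec_eq_iff; simp add: scaleR_conv_of_real)
    have "poly_act B p v = (\<Sum>i\<le>N. (u i *\<^sub>R X i) *v v)"
      unfolding p_def poly_act_sum poly_act_monom X[symmetric] linear_scale[OF lin]
      by (simp add: scale)
    also have "\<dots> = (\<Sum>i\<le>N. u i *\<^sub>R X i) *v v"
      by (simp add: linear_sum[OF lin])
    finally show ?thesis
      by (simp add: u(2))
  qed
  ultimately show ?thesis by blast
qed

text \<open>Once \<open>\<bar>e k\<bar> \<le> (1 - \<bar>z\<bar>) r / 2\<close>, the recurrence does not lead out of the ball of radius \<open>r / 2\<close>,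
  and the part of the initial value that exceeds it decays geometrically.\<close>

lemma tendsto_zero_of_contracting_recurrence:
  fixes x e :: "nat \<Rightarrow> 'a::real_normed_field"
  assumes rec: "\<And>k. x (Suc k) = z * x k + e k" and z: "norm z < 1" and e: "e \<longlonglongrightarrow> 0"
  shows "x \<longlonglongrightarrow> 0"
proof (rule LIMSEQ_I)
  fix r :: real assume "r > 0"
  let ?q = "norm z"
  have "0 < (1 - ?q) * (r / 2)"
    using z \<open>r > 0\<close> by simp
  with e obtain N where N: "\<And>k. k \<ge> N \<Longrightarrow> norm (e k) < (1 - ?q) * (r / 2)"
    by (metis LIMSEQ_D diff_zero)
  have bound: "norm (x (N + j)) \<le> ?q ^ j * norm (x N) + r / 2" for j
  proof (induction j)
    case 0
    then show ?case using \<open>r > 0\<close> by simp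
  next
    case (Suc j)
    have "norm (x (N + Suc j)) \<le> ?q * norm (x (N + j)) + norm (e (N + j))"
      using norm_triangle_ineq[of "z * x (N + j)" "e (N + j)"] by (simp add: rec norm_mult)
    also have "\<dots> \<le> ?q * (?q ^ j * norm (x N) + r / 2) + (1 - ?q) * (r / 2)"
      by (intro add_mono mult_left_mono Suc) (use N[of "N + j"] in auto)
    finally show ?case
      by (simp add: algebra_simps diff_divide_distrib)
  qed
  have "(\<lambda>j. ?q ^ j * norm (x N)) \<longlonglongrightarrow> 0"
    using z by (intro tendsto_mult_left_zero LIMSEQ_power_zero) simp
  then obtain J where J: "\<And>j. j \<ge> J \<Longrightarrow> norm (?q ^ j * norm (x N)) < r / 2"
    using \<open>r > 0\<close> by (metis LIMSEQ_D diff_zero half_gt_zero)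
  have "norm (x n) < r" if "n \<ge> N + J" for n
  proof -
    have "norm (x n) \<le> ?q ^ (n - N) * norm (x N) + r / 2"
      using bound[of "n - N"] that by simp
    moreover have "norm (?q ^ (n - N) * norm (x N)) < r / 2"
      by (rule J) (use that in simp)
    ultimately show ?thesis by simp
  qed
  then show "\<exists>no. \<forall>n\<ge>no. norm (x n - 0) < r"
    by auto
qed

text \<open>Induction on the degree of the annihilator \<open>p = (X - z) q\<close>. If \<open>q\<close> annihilates \<open>v\<close> as well,
  the induction hypothesis applies to \<open>v\<close> itself. Otherwise \<open>q(B) v\<close> is an eigenvector for \<open>z\<close>, hence
  \<open>\<bar>z\<bar> < 1\<close>; the induction hypothesis applies to \<open>w = B v - z v\<close>, and the powers applied to \<open>v\<close>
  satisfy a contracting recurrence with the perturbation \<open>B\<^sup>k w\<close>.\<close>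

lemma iterates_tendsto_zero_of_annihilator:
  fixes B :: "complex^'n^'n"
  assumes "\<And>z w. B *v w = z *s w \<Longrightarrow> w \<noteq> 0 \<Longrightarrow> cmod z < 1"
    and "p \<noteq> 0" and "poly_act B p v = 0"
  shows "(\<lambda>k. ((*v) B ^^ k) v) \<longlonglongrightarrow> 0"
  using assms(2,3)
proof (induction "degree p" arbitrary: p v)
  case 0
  then obtain a where "p = [:a:]"
    by (metis degree_eq_zeroE)
  with 0 have "v = 0"
    by (auto simp: vec_eq_iff)
  moreover have "((*v) B ^^ k) 0 = 0" for k
    by (induction k) simp_all
  ultimately show ?case by simp
next
  case (Suc n)
  then have "\<not> constant (poly p)"
    by (simp add: constant_degree)
  then obtain z where "poly p z = 0"
    using fundamental_theorem_of_algebra by blast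
  then obtain q where q: "p = [:- z, 1:] * q"
    by (metis poly_eq_0_iff_dvd dvdE)
  with Suc.prems have "q \<noteq> 0" by auto
  with q Suc.hyps have deg: "n = degree q"
    by (simp add: degree_mult_eq del: mult_pCons_left)
  show ?case
  proof (cases "poly_act B q v = 0")
    case True
    show ?thesis
      by (rule Suc.hyps(1)[OF deg \<open>q \<noteq> 0\<close> True])
  next
    case False
    let ?w = "B *v v - z *s v"
    have w: "poly_act B q ?w = 0"
      using Suc.prems(2) unfolding q poly_act_linear_factor(1) .
    then have "B *v poly_act B q v = z *s poly_act B q v"
      unfolding poly_act_linear_factor(2) by simp
    with False have z: "cmod z < 1"
      using assms(1) by blast
    have lim: "(\<lambda>k. ((*v) B ^^ k) ?w) \<longlonglongrightarrow> 0"
      by (rule Suc.hyps(1)[OF deg \<open>q \<noteq> 0\<close> w])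
    have step: "((*v) B ^^ Suc k) v = z *s ((*v) B ^^ k) v + ((*v) B ^^ k) ?w" for k
    proof -
      have "((*v) B ^^ k) ?w = ((*v) B ^^ k) (B *v v) - z *s ((*v) B ^^ k) v"
        by (induction k) (simp_all add: matrix_vector_mult_diff_distrib vector_scalar_commute)
      then show ?thesis
        by (simp add: funpow_swap1)
    qed
    show ?thesis
    proof (rule vec_tendstoI)
      fix i
      show "(\<lambda>k. ((*v) B ^^ k) v $ i) \<longlonglongrightarrow> 0 $ i"
        unfolding zero_index
      proof (rule tendsto_zero_of_contracting_recurrence[OF _ z])
        show "((*v) B ^^ Suc k) v $ i = z * ((*v) B ^^ k) v $ i + ((*v) B ^^ k) ?w $ i" for k
          unfolding step by simp
        show "(\<lambda>k. ((*v) B ^^ k) ?w $ i) \<longlonglongrightarrow> 0"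
          using tendsto_vec_nth[OF lim, of i] by simp
      qed
    qed
  qed
qed

text \<open>Finiteness is what makes the maximum in \<open>matrix_spectral_radius\<close> an upper bound of
  the moduli of the eigenvalues.\<close>

lemma finite_matrix_spectrum: "finite (matrix_spectrum A)"
proof -
  obtain p where p: "p \<noteq> 0" "\<And>v. poly_act (map_matrix complex_of_real A) p v = 0"
    using annihilating_polynomial by blast
  have "matrix_spectrum A \<subseteq> {z. poly p z = 0}"
  proof
    fix z assume "z \<in> matrix_spectrum A"
    then obtain v where "v \<noteq> 0" "map_matrix complex_of_real A *v v = z *s v"
      by (auto simp: matrix_spectrum_def)
    with poly_act_eigenvector[of "map_matrix complex_of_real A" v z p] p(2)
    show "z \<in> {z. poly p z = 0}"
      by (auto simp: vec_eq_iff)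
  qed
  then show ?thesis
    by (rule finite_subset) (rule poly_roots_finite[OF p(1)])
qed

lemma matrix_pow_vector_tendsto_zero:
  fixes A :: "real^'n^'n"
  assumes "matrix_spectral_radius A < 1"
  shows "(\<lambda>k. matrix_pow A k *v x) \<longlonglongrightarrow> 0"
proof -
  let ?B = "map_matrix complex_of_real A"
  define c :: "real^'n \<Rightarrow> complex^'n" where "c y = (\<chi> i. complex_of_real (y $ i))" for y
  obtain p where p: "p \<noteq> 0" "poly_act ?B p (c x) = 0"
    using annihilating_polynomial by blast
  have eig: "cmod z < 1" if "?B *v w = z *s w" "w \<noteq> 0" for z w
  proof -
    have "cmod z \<le> matrix_spectral_radius A"
      unfolding matrix_spectral_radius_def
    proof (rule Max_ge)
      show "finite (cmod ` matrix_spectrum A)"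
        by (intro finite_imageI finite_matrix_spectrum)
      show "cmod z \<in> cmod ` matrix_spectrum A"
        using that by (auto simp: matrix_spectrum_def)
    qed
    with assms show ?thesis by simp
  qed
  have step: "?B *v c y = c (A *v y)" for y
    by (simp add: c_def vec_eq_iff matrix_vector_mult_def map_matrix_def)
  have iter: "((*v) ?B ^^ k) (c x) = c (matrix_pow A k *v x)" for k
    by (induction k) (simp_all add: step matrix_vector_mul_assoc)
  have lim: "(\<lambda>k. ((*v) ?B ^^ k) (c x)) \<longlonglongrightarrow> 0"
    using eig p by (rule iterates_tendsto_zero_of_annihilator)
  show ?thesis
  proof (rule vec_tendstoI)
    fix i
    have "(\<lambda>k. complex_of_real ((matrix_pow A k *v x) $ i)) \<longlonglongrightarrow> complex_of_real 0"
      using tendsto_vec_nth[OF lim[unfolded iter], of i] by (simp add: c_def)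
    then show "(\<lambda>k. (matrix_pow A k *v x) $ i) \<longlonglongrightarrow> 0 $ i"
      unfolding tendsto_of_real_iff by simp
  qed
qed

text \<open>With this bound, convergence of the powers on the finitely many basis vectors gives convergence
  in operator norm.\<close>

lemma matrix_opnorm_le_sum_columns:
  fixes A :: "real^'n^'n"
  shows "matrix_opnorm A \<le> (\<Sum>i\<in>UNIV. norm (A *v axis i 1))"
  unfolding matrix_opnorm_def
proof (rule onorm_le)
  fix x :: "real^'n"
  have "norm (A *v x) = norm (\<Sum>i\<in>UNIV. (x $ i) *\<^sub>R (A *v axis i 1))"
    by (simp add: matrix_mult_sum[of A x] matrix_vector_mult_basis scalar_mult_eq_scaleR)
  also have "\<dots> \<le> (\<Sum>i\<in>UNIV. norm x * norm (A *v axis i 1))"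
    by (intro sum_norm_le) (simp add: mult_right_mono component_le_norm_cart)
  finally show "norm (A *v x) \<le> (\<Sum>i\<in>UNIV. norm (A *v axis i 1)) * norm x"
    by (simp add: sum_distrib_left mult.commute)
qed

lemma eventually_opnorm_matrix_pow_less_1:
  fixes A :: "real^'n^'n"
  assumes "matrix_spectral_radius A < 1"
  shows "\<forall>\<^sub>F k in sequentially. matrix_opnorm (matrix_pow A k) < 1"
proof -
  have "(\<lambda>k. \<Sum>i\<in>UNIV. norm (matrix_pow A k *v axis i 1)) \<longlonglongrightarrow> (\<Sum>i\<in>(UNIV::'n set). norm (0::real^'n))"
    by (intro tendsto_intros matrix_pow_vector_tendsto_zero assms)
  then have "\<forall>\<^sub>F k in sequentially. (\<Sum>i\<in>UNIV. norm (matrix_pow A k *v axis i 1)) < 1"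
    by (intro order_tendstoD(2)[where y=0]) simp_all
  then show ?thesis
    by eventually_elim (use matrix_opnorm_le_sum_columns le_less_trans in blast)
qed

lemma p_tilde_works:
  assumes "matrix_spectral_radius (jacobian f (at 0)) < 1"
  shows "1 \<le> p_tilde f"
    and "p_tilde f \<le> p \<Longrightarrow> matrix_opnorm (matrix_pow (jacobian f (at 0)) p) < 1"
proof -
  let ?P = "\<lambda>q. 1 \<le> q \<and> (\<forall>p\<ge>q. matrix_opnorm (matrix_pow (jacobian f (at 0)) p) < 1)"
  obtain N where "\<And>p. p \<ge> N \<Longrightarrow> matrix_opnorm (matrix_pow (jacobian f (at 0)) p) < 1"
    using eventually_opnorm_matrix_pow_less_1[OF assms] by (auto simp: eventually_sequentially)
  then have "?P (max 1 N)" by simp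
  then have "?P (p_tilde f)"
    unfolding p_tilde_def by (rule LeastI)
  then show "1 \<le> p_tilde f"
    and "p_tilde f \<le> p \<Longrightarrow> matrix_opnorm (matrix_pow (jacobian f (at 0)) p) < 1"
    by blast+
qed

section \<open>Differentiability of real analytic maps\<close>

text \<open>In finite dimension unconditional summability is absolute, as it is in each coordinate.\<close>

lemma summable_on_imp_abs_summable_on_cart:
  fixes g :: "'a \<Rightarrow> real^'m"
  assumes "g summable_on S"
  shows "(\<lambda>m. norm (g m)) summable_on S"
proof -
  have "(\<lambda>m. g m $ i) summable_on S" for i
    using summable_on_bounded_linear[OF bounded_linear_vec_nth assms] by simp
  then have "(\<lambda>m. \<bar>g m $ i\<bar>) summable_on S" for i
    using summable_on_iff_abs_summable_on_real[of "\<lambda>m. g m $ i" S] by simp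
  then have "(\<lambda>m. \<Sum>i\<in>UNIV. \<bar>g m $ i\<bar>) summable_on S"
  proof -
    have "(\<lambda>m. \<Sum>i\<in>J. \<bar>g m $ i\<bar>) summable_on S" if "finite J" for J
      using that by induction (simp_all add: summable_on_add \<open>\<And>i. (\<lambda>m. \<bar>g m $ i\<bar>) summable_on S\<close>)
    then show ?thesis by simp
  qed
  then show ?thesis
    by (rule Infinite_Sum.abs_summable_on_comparison_test') (rule norm_le_l1_cart)
qed

text \<open>A monomial of degree \<open>d \<ge> 2\<close> is at most \<open>t\<^sup>d = (t / s)\<^sup>d s\<^sup>d\<close>, and \<open>(t / s)\<^sup>d \<le> (t / s)\<^sup>2\<close>. The
  quadratic factor does not depend on the monomial, so it can be taken out of the series.\<close>

lemma prod_power_le: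
  fixes h :: "real^'n"
  assumes "norm h \<le> t" and "t \<le> s" and "0 < s" and "2 \<le> (\<Sum>i\<in>UNIV. m i)"
  shows "\<bar>\<Prod>i\<in>UNIV. (h $ i) ^ m i\<bar> \<le> (t / s)\<^sup>2 * (\<Prod>i\<in>(UNIV::'n set). s ^ m i)"
proof -
  have t: "0 \<le> t" using norm_ge_zero[of h] assms(1) by linarith
  let ?d = "\<Sum>i\<in>UNIV. m i"
  have "\<bar>\<Prod>i\<in>UNIV. (h $ i) ^ m i\<bar> \<le> (\<Prod>i\<in>(UNIV::'n set). t ^ m i)"
    unfolding abs_prod power_abs
    by (intro prod_mono conjI power_mono order_trans[OF component_le_norm_cart assms(1)]) auto
  also have "\<dots> = (t / s) ^ ?d * s ^ ?d"
    using assms(3) by (simp add: power_sum[symmetric] power_divide)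
  also have "\<dots> \<le> (t / s) ^ 2 * s ^ ?d"
    using t assms by (intro mult_right_mono power_decreasing) auto
  finally show ?thesis
    by (simp add: power_sum)
qed

text \<open>The derivative at the centre is the linear part \<open>L\<close> of the series. Absolute convergence at one
  point with all coordinates equal to \<open>s > 0\<close> bounds the sum of all terms of degree at least \<open>2\<close> at
  \<open>h\<close> by \<open>(\<bar>h\<bar> / s)\<^sup>2 C\<close>.\<close>

lemma real_analytic_on_imp_differentiable:
  fixes f :: "real^'n \<Rightarrow> real^'m"
  assumes "real_analytic_on f \<Omega>" and "a \<in> \<Omega>"
  shows "f differentiable (at a)"
proof -
  obtain r c where r: "r > 0" and series: "\<And>x. x \<in> ball a r \<Longrightarrow>
      ((\<lambda>m. (\<Prod>i\<in>UNIV. (x $ i - a $ i) ^ m i) *\<^sub>R c m) has_sum f x) UNIV"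
    using assms unfolding real_analytic_on_def by meson
  define e :: "'n \<Rightarrow> 'n \<Rightarrow> nat" where "e j = (\<lambda>i. if i = j then 1 else 0)" for j
  \<comment> \<open>\<open>e j\<close> is the exponent of the monomial \<open>h $ j\<close>, and \<open>F\<close> is the set of exponents of degree at
    most \<open>1\<close>.\<close>
  define F where "F = insert (\<lambda>_. 0) (range e)"
  define L where "L h = (\<Sum>j\<in>UNIV. (h $ j) *\<^sub>R c (e j))" for h :: "real^'n"
  have inj: "inj e"
    by (rule injI) (metis e_def zero_neq_one)
  have e0: "(\<lambda>_. 0) \<notin> range e"
  proof
    assume "(\<lambda>_. 0) \<in> range e"
    then obtain j where "(\<lambda>_. 0) = e j" by blast
    from fun_cong[OF this, of j] show False by (simp add: e_def)
  qed
  have prod_e: "(\<Prod>i\<in>UNIV. (h i :: real) ^ e j i) = h j" for h j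
  proof -
    have "h i ^ e j i = (if i = j then h i else 1)" for i
      by (simp add: e_def)
    then show ?thesis by simp
  qed
  have sum_F: "(\<Sum>m\<in>F. (\<Prod>i\<in>UNIV. (h $ i) ^ m i) *\<^sub>R c m) = c (\<lambda>_. 0) + L h" for h
    using e0 by (simp add: F_def L_def sum.reindex[OF inj] prod_e)
  have remainder: "((\<lambda>m. (\<Prod>i\<in>UNIV. (h $ i) ^ m i) *\<^sub>R c m) has_sum 
       (f (a + h) - (c (\<lambda>_. 0) + L h))) (UNIV - F)"
    if "norm h < r" for h
  proof -
    have "((\<lambda>m. (\<Prod>i\<in>UNIV. (h $ i) ^ m i) *\<^sub>R c m) has_sum f (a + h)) UNIV"
      using series[of "a + h"] that by (simp add: dist_norm)
    moreover have "((\<lambda>m. (\<Prod>i\<in>UNIV. (h $ i) ^ m i) *\<^sub>R c m) has_sum (c (\<lambda>_. 0) + L h)) F"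
      unfolding sum_F[symmetric] by (rule has_sum_finite) (simp add: F_def)
    ultimately show ?thesis
      by (intro has_sum_Diff) auto
  qed
  have large: "2 \<le> (\<Sum>i\<in>UNIV. m i)" if "m \<in> UNIV - F" for m :: "'n \<Rightarrow> nat"
  proof (rule ccontr)
    assume small: "\<not> 2 \<le> (\<Sum>i\<in>UNIV. m i)"
    from that obtain j where j: "m j \<noteq> 0"
      by (auto simp: F_def)
    have split: "(\<Sum>i\<in>UNIV. m i) = m j + (\<Sum>i\<in>UNIV - {j}. m i)"
      by (rule sum.remove) auto
    with small j have "m j = 1" "(\<Sum>i\<in>UNIV - {j}. m i) = 0" by linarith+
    then have "m = e j"
      by (auto simp: e_def fun_eq_iff)
    with that show False by (auto simp: F_def)
  qed
  \<comment> \<open>The denominator keeps the point with all coordinates \<open>s\<close> within the ball of radius \<open>r\<close>: its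
    norm is at most the sum of its coordinates, which is \<open>r / 2\<close>.\<close>
  define s where "s = r / (2 * real CARD('n))"
  have s: "0 < s" "s < r"
  proof -
    have "1 \<le> real CARD('n)"
      using zero_less_card_finite[where 'a='n] by linarith
    moreover have "r / (2 * k) < r" if "1 \<le> k" for k
      using r that by (simp add: field_simps)
    ultimately show "0 < s" "s < r"
      using r by (simp_all add: s_def)
  qed
  let ?b = "\<chi> i. s :: real^'n"
  have "norm ?b \<le> (\<Sum>i\<in>(UNIV::'n set). \<bar>?b $ i\<bar>)"
    by (rule norm_le_l1_cart)
  also have "\<dots> = r / 2"
    using r by (simp add: s_def)
  finally have "norm ?b < r" using r by simp
  from remainder[OF this]
  have "(\<lambda>m. norm ((\<Prod>i\<in>UNIV. (?b $ i) ^ m i) *\<^sub>R c m)) summable_on (UNIV - F)"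
    by (intro summable_on_imp_abs_summable_on_cart) (rule has_sum_imp_summable)
  then obtain C where C: "((\<lambda>m. (\<Prod>i\<in>(UNIV::'n set). s ^ m i) * norm (c m)) has_sum C) (UNIV - F)"
    using s(1) by (auto simp: summable_on_def abs_prod)
  have C0: "0 \<le> C"
    using C by (rule has_sum_nonneg) (use s in \<open>auto intro!: mult_nonneg_nonneg prod_nonneg\<close>)
  have quad: "norm (f (a + h) - (c (\<lambda>_. 0) + L h)) \<le> (norm h / s)\<^sup>2 * C" if "norm h \<le> s" for h
  proof (rule norm_infsum_le[OF remainder])
    show "norm h < r" using that s by simp
    show "((\<lambda>m. (norm h / s)\<^sup>2 * ((\<Prod>i\<in>(UNIV::'n set). s ^ m i) * norm (c m))) has_sum
        (norm h / s)\<^sup>2 * C) (UNIV - F)"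
      by (rule has_sum_cmult_right[OF C])
    show "norm ((\<Prod>i\<in>UNIV. (h $ i) ^ m i) *\<^sub>R c m)
        \<le> (norm h / s)\<^sup>2 * ((\<Prod>i\<in>(UNIV::'n set). s ^ m i) * norm (c m))" if "m \<in> UNIV - F" for m
      using mult_right_mono[OF prod_power_le[OF order_refl \<open>norm h \<le> s\<close> s(1) large[OF that]], of "norm (c m)"]
      by (simp add: mult.assoc)
  qed
  have L0: "L 0 = 0" by (simp add: L_def)
  have fa: "f a = c (\<lambda>_. 0)"
    using quad[of 0] s by (simp add: L0)
  have "bounded_linear L"
    unfolding L_def
    by (intro bounded_linear_sum bounded_linear_scaleR_const bounded_linear_vec_nth)
  moreover have "\<exists>d>0. \<forall>y. norm (y - a) < d \<longrightarrow> norm (f y - f a - L (y - a)) \<le> \<epsilon> * norm (y - a)"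
    if "\<epsilon> > 0" for \<epsilon>
    \<comment> \<open>\<open>C + 1\<close> instead of \<open>C\<close> avoids a division by zero for affine \<open>f\<close>.\<close>
  proof (intro exI[of _ "min s (\<epsilon> * s\<^sup>2 / (C + 1))"] conjI allI impI)
    show "0 < min s (\<epsilon> * s\<^sup>2 / (C + 1))"
      using that s C0 by simp
    fix y assume y: "norm (y - a) < min s (\<epsilon> * s\<^sup>2 / (C + 1))"
    let ?t = "norm (y - a)"
    have "norm (f y - f a - L (y - a)) \<le> (?t / s)\<^sup>2 * C"
      using quad[of "y - a"] y by (simp add: fa algebra_simps)
    also have "\<dots> \<le> (?t / s)\<^sup>2 * (C + 1)"
      by (intro mult_left_mono) auto
    also have "\<dots> = (?t * (C + 1) / s\<^sup>2) * ?t"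
      by (simp add: power2_eq_square)
    also have "\<dots> \<le> \<epsilon> * ?t"
      using y s C0 by (intro mult_right_mono) (auto simp: field_simps)
    finally show "norm (f y - f a - L (y - a)) \<le> \<epsilon> * ?t" .
  qed
  ultimately have "(f has_derivative L) (at a)"
    by (simp add: has_derivative_at_alt)
  then show ?thesis
    by (auto simp: differentiable_def)
qed

section \<open>Iterates near a fixed point\<close>

lemma funpow_maps_to: "f \<in> \<Omega> \<rightarrow> \<Omega> \<Longrightarrow> x \<in> \<Omega> \<Longrightarrow> (f ^^ k) x \<in> \<Omega>"
  by (induction k) auto

lemma funpow_fixed_point: "f a = a \<Longrightarrow> (f ^^ k) a = a"
  by (induction k) auto

lemma continuous_on_funpow:
  assumes "continuous_on \<Omega> f" and "f \<in> \<Omega> \<rightarrow> \<Omega>"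
  shows "continuous_on \<Omega> (f ^^ k)"
proof (induction k)
  case (Suc k)
  have "(f ^^ k) ` \<Omega> \<subseteq> \<Omega>"
    using funpow_maps_to[OF assms(2)] by blast
  from continuous_on_compose[OF Suc continuous_on_subset[OF assms(1) this]] show ?case
    by simp
qed simp

lemma has_derivative_funpow:
  fixes f :: "real^'n \<Rightarrow> real^'n"
  assumes "f differentiable (at 0)" and "f 0 = 0"
  shows "((f ^^ k) has_derivative (\<lambda>h. matrix_pow (jacobian f (at 0)) k *v h)) (at 0)"
proof (induction k)
  case 0
  then show ?case by (simp add: has_derivative_ident id_def)
next
  case (Suc k)
  have "(f has_derivative (\<lambda>h. jacobian f (at 0) *v h)) (at ((f ^^ k) 0))"
    using assms(1) unfolding funpow_fixed_point[of f 0, OF assms(2)] jacobian_works .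
  from diff_chain_at[OF Suc this] show ?case
    by (simp add: o_def matrix_vector_mul_assoc)
qed

text \<open>The remainder of the linear approximation is allowed half of the gap \<open>1 - \<parallel>A\<parallel>\<close>. The conclusion is
  stated for all sufficiently small radii, so that it combines over finitely many maps.\<close>

lemma derivative_opnorm_less_1_imp_norm_decreasing:
  fixes g :: "real^'n \<Rightarrow> real^'n"
  assumes g: "(g has_derivative (\<lambda>h. A *v h)) (at 0)" and "g 0 = 0" and A: "matrix_opnorm A < 1"
  shows "\<forall>\<^sub>F d in at_right 0. \<forall>x. norm x < d \<longrightarrow> x \<noteq> 0 \<longrightarrow> norm (g x) < norm x"
proof -
  let ?e = "(1 - matrix_opnorm A) / 2"
  have "?e > 0" using A by simp
  with g obtain d where d: "d > 0"
    "\<And>x. norm x < d \<Longrightarrow> norm (g x - A *v x) \<le> ?e * norm x"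
    unfolding has_derivative_at_alt using \<open>g 0 = 0\<close> by (metis diff_zero)
  have "norm (g x) < norm x" if "norm x < d" "x \<noteq> 0" for x
  proof -
    have "norm (A *v x) \<le> matrix_opnorm A * norm x"
      unfolding matrix_opnorm_def by (rule onorm[OF matrix_vector_mul_bounded_linear])
    then have "norm (g x) \<le> ?e * norm x + matrix_opnorm A * norm x"
      using d(2)[OF that(1)] norm_triangle_sub[of "g x" "A *v x"] by linarith
    also have "\<dots> = (1 - ?e) * norm x"
      by (simp add: algebra_simps add_divide_distrib diff_divide_distrib)
    also have "\<dots> < norm x"
      using \<open>?e > 0\<close> that(2) by simp
    finally show ?thesis .
  qed
  then show ?thesis
    unfolding eventually_at_right_field using d(1) by (meson less_trans)
qed

text \<open>The decrease is not uniform, so the orbit need not contract geometrically; compactness replaces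
  this. The norms along the orbit decrease to some \<open>l\<close>. A limit point \<open>z\<close> and its image \<open>g z\<close>
  both have norm \<open>l\<close>, which the strict decrease permits only for \<open>z = 0\<close>.\<close>

lemma iterates_tendsto_zero_of_norm_decreasing:
  fixes g :: "'a::euclidean_space \<Rightarrow> 'a"
  assumes cont: "continuous_on (cball 0 (norm y)) g" and "g 0 = 0"
    and less: "\<And>x. norm x \<le> norm y \<Longrightarrow> x \<noteq> 0 \<Longrightarrow> norm (g x) < norm x"
  shows "(\<lambda>k. (g ^^ k) y) \<longlonglongrightarrow> 0"
proof -
  define X where "X k = (g ^^ k) y" for k
  have le: "norm (g x) \<le> norm x" if "norm x \<le> norm y" for x
    using less[OF that] \<open>g 0 = 0\<close> by (cases "x = 0") auto
  have X: "X k \<in> cball 0 (norm y)" for k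
  proof (induction k)
    case (Suc k)
    then show ?case
      using le[of "X k"] by (simp add: X_def)
  qed (simp add: X_def)
  have dec: "decseq (\<lambda>k. norm (X k))"
    using le X by (auto simp: decseq_Suc_iff X_def)
  obtain l where l: "(\<lambda>k. norm (X k)) \<longlonglongrightarrow> l"
    using decseq_convergent[OF dec, of 0] by auto
  obtain z r where z: "z \<in> cball 0 (norm y)" and r: "strict_mono r" and lim: "(X \<circ> r) \<longlonglongrightarrow> z"
    using compact_cball[of 0 "norm y"] X unfolding compact_def by meson
  have "norm z = l"
    using LIMSEQ_unique[OF tendsto_norm[OF lim]] LIMSEQ_subseq_LIMSEQ[OF l r] by (simp add: o_def)
  have "(\<lambda>k. g (X (r k))) \<longlonglongrightarrow> g z"
    using continuous_on_tendsto_compose[OF cont lim z] X by (simp add: o_def)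
  then have "(\<lambda>k. norm (X (Suc (r k)))) \<longlonglongrightarrow> norm (g z)"
    by (intro tendsto_norm) (simp add: X_def)
  moreover have "(\<lambda>k. norm (X (Suc (r k)))) \<longlonglongrightarrow> l"
    using LIMSEQ_subseq_LIMSEQ[OF LIMSEQ_Suc[OF l] r] by (simp add: o_def)
  ultimately have "norm (g z) = norm z"
    using LIMSEQ_unique \<open>norm z = l\<close> by blast
  then have "z = 0"
    using less[of z] z by force
  with l \<open>norm z = l\<close> show ?thesis
    by (simp add: X_def tendsto_norm_zero_iff)
qed

section \<open>The largest admissible radius\<close>

text \<open>A point of the open ball whose radius is the supremum of the admissible radii already lies in an
  admissible ball, so the supremum is itself admissible, hence the greatest admissible radius. It is
  positive because the finitely many iterates in question all have a derivative of norm less than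
  \<open>1\<close> at \<open>0\<close>.\<close>

lemma R_tilde_works:
  fixes f :: "real^'n \<Rightarrow> real^'n"
  assumes "open \<Omega>" and "0 \<in> \<Omega>" and diff: "f differentiable (at 0)" and "f 0 = 0"
    and rho: "matrix_spectral_radius (jacobian f (at 0)) < 1"
  shows "0 < R_tilde \<Omega> f" and "zero_ball (R_tilde \<Omega> f) \<subseteq> \<Omega>"
    and "\<forall>p\<in>{p_tilde f..2 * p_tilde f - 1}. \<forall>x\<in>zero_ball (R_tilde \<Omega> f) - {0}.
           norm ((f ^^ p) x) < norm x"
proof -
  let ?I = "{p_tilde f..2 * p_tilde f - 1}"
  let ?P = "\<lambda>r. 0 < r \<and> zero_ball r \<subseteq> \<Omega> \<and>
    (\<forall>p\<in>?I. \<forall>x\<in>zero_ball r - {0}. norm ((f ^^ p) x) < norm x)"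
  have "\<forall>\<^sub>F d in at_right 0. \<forall>p\<in>?I. \<forall>x. norm x < d \<longrightarrow> x \<noteq> 0 \<longrightarrow> norm ((f ^^ p) x) < norm x"
  proof (intro eventually_ball_finite ballI finite_atLeastAtMost)
    fix p assume "p \<in> ?I"
    then have "matrix_opnorm (matrix_pow (jacobian f (at 0)) p) < 1"
      using p_tilde_works(2)[OF rho] by simp
    then show "\<forall>\<^sub>F d in at_right 0. \<forall>x. norm x < d \<longrightarrow> x \<noteq> 0 \<longrightarrow> norm ((f ^^ p) x) < norm x"
      by (rule derivative_opnorm_less_1_imp_norm_decreasing[OF has_derivative_funpow[OF diff \<open>f 0 = 0\<close>]
            funpow_fixed_point[of f 0, OF \<open>f 0 = 0\<close>]])
  qed
  moreover obtain r where r: "r > 0" "ball 0 r \<subseteq> \<Omega>"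
    using assms(1,2) by (metis open_contains_ball)
  then have "\<forall>\<^sub>F d in at_right 0. 0 < d \<and> ball 0 d \<subseteq> \<Omega>"
    unfolding eventually_at_right_field
    by (intro exI[of _ r]) auto
  ultimately have "\<forall>\<^sub>F d in at_right 0. ?P (ereal d)"
    by eventually_elim (auto simp: zero_ball_def ball_def)
  then obtain d where d: "?P (ereal d)"
    using eventually_happens'[OF trivial_limit_at_right_real] by blast
  let ?R = "Sup (Collect ?P)"
  have below_Sup: "\<exists>r. ?P r \<and> x \<in> zero_ball r" if "x \<in> zero_ball ?R" for x :: "real^'n"
    using that unfolding zero_ball_def less_Sup_iff by auto
  have R: "?P ?R"
  proof (intro conjI)
    show "0 < ?R"
    proof (rule less_le_trans)
      show "ereal d \<le> ?R"
        by (rule Sup_upper) (use d in simp)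
    qed (use d in simp)
    show "zero_ball ?R \<subseteq> \<Omega>"
      using below_Sup by blast
    show "\<forall>p\<in>?I. \<forall>x\<in>zero_ball ?R - {0}. norm ((f ^^ p) x) < norm x"
      using below_Sup by blast
  qed
  have "R_tilde \<Omega> f = ?R"
    unfolding R_tilde_def
  proof (rule Greatest_equality)
    show "?P ?R" by (rule R)
    show "r \<le> ?R" if "?P r" for r
      by (rule Sup_upper, rule CollectI, rule that)
  qed
  then have "?P (R_tilde \<Omega> f)"
    by (rule ssubst[of _ _ ?P]) (rule R)
  then show "0 < R_tilde \<Omega> f" and "zero_ball (R_tilde \<Omega> f) \<subseteq> \<Omega>"
    and "\<forall>p\<in>?I. \<forall>x\<in>zero_ball (R_tilde \<Omega> f) - {0}. norm ((f ^^ p) x) < norm x"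
    by blast+
qed

lemma zero_ball_mono_norm: "x \<in> zero_ball R \<Longrightarrow> norm y \<le> norm x \<Longrightarrow> y \<in> zero_ball R"
  using le_less_trans[of "ereal (norm y)" "ereal (norm x)" R] by (simp add: zero_ball_def)

text \<open>An exponent beyond the window is reduced by \<open>q\<close>: it stays at least \<open>q\<close>, because the window
  ends at \<open>2 * q - 1\<close>, and the shorter iterate keeps the point in the ball where the factor \<open>f ^^ q\<close>
  does not increase the norm.\<close>

lemma norm_funpow_le:
  fixes f :: "real^'n \<Rightarrow> real^'n"
  assumes "1 \<le> q" and "f 0 = 0"
    and dec: "\<forall>p\<in>{q..2 * q - 1}. \<forall>x\<in>zero_ball R - {0}. norm ((f ^^ p) x) < norm x"
    and "q \<le> p" and "x \<in> zero_ball R"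
  shows "norm ((f ^^ p) x) \<le> norm x"
  using assms(4,5)
proof (induction p rule: less_induct)
  case (less p)
  have step: "norm ((f ^^ p) x) \<le> norm x" if "p \<in> {q..2 * q - 1}" "x \<in> zero_ball R" for p x
  proof (cases "x = 0")
    case True
    then show ?thesis by (simp add: funpow_fixed_point[of f 0] \<open>f 0 = 0\<close>)
  next
    case False
    with that dec have "norm ((f ^^ p) x) < norm x" by blast
    then show ?thesis by simp
  qed
  show ?case
  proof (cases "p \<le> 2 * q - 1")
    case True
    with less.prems step show ?thesis by simp
  next
    case False
    then have "p - q < p" "q \<le> p - q"
      using \<open>1 \<le> q\<close> by linarith+
    then have IH: "norm ((f ^^ (p - q)) x) \<le> norm x"
      using less by blast
    have "(f ^^ p) x = (f ^^ q) ((f ^^ (p - q)) x)"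
      using less.prems(1) by (metis comp_apply funpow_add le_add_diff_inverse)
    also have "norm \<dots> \<le> norm ((f ^^ (p - q)) x)"
      using zero_ball_mono_norm[OF less.prems(2) IH] \<open>1 \<le> q\<close> by (intro step) auto
    finally show ?thesis using IH by linarith
  qed
qed

text \<open>The iterates of \<open>f ^^ q\<close> tend to \<open>0\<close> by strict decrease of the norm. Any later iterate of \<open>f\<close> is
  reached from one of them in at least \<open>q\<close> further steps, which do not increase the norm.\<close>

lemma funpow_tendsto_zero:
  fixes f :: "real^'n \<Rightarrow> real^'n"
  assumes "1 \<le> q" and "f 0 = 0" and cont: "continuous_on (zero_ball R) (f ^^ q)"
    and dec: "\<forall>p\<in>{q..2 * q - 1}. \<forall>x\<in>zero_ball R - {0}. norm ((f ^^ p) x) < norm x"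
    and y: "y \<in> zero_ball R"
  shows "(\<lambda>n. (f ^^ n) y) \<longlonglongrightarrow> 0"
proof (rule LIMSEQ_I)
  fix e :: real assume "e > 0"
  have sub: "x \<in> zero_ball R" if "norm x \<le> norm y" for x
    using zero_ball_mono_norm[OF y that] .
  have "(\<lambda>k. ((f ^^ q) ^^ k) y) \<longlonglongrightarrow> 0"
  proof (rule iterates_tendsto_zero_of_norm_decreasing)
    show "continuous_on (cball 0 (norm y)) (f ^^ q)"
      by (rule continuous_on_subset[OF cont]) (use sub in auto)
    show "(f ^^ q) 0 = 0"
      by (rule funpow_fixed_point) fact
    show "norm ((f ^^ q) x) < norm x" if "norm x \<le> norm y" "x \<noteq> 0" for x
    proof -
      have "q \<in> {q..2 * q - 1}" and "x \<in> zero_ball R - {0}"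
        using that sub \<open>1 \<le> q\<close> by auto
      with dec show ?thesis by blast
    qed
  qed
  from LIMSEQ_D[OF this \<open>e > 0\<close>] obtain k where "norm (((f ^^ q) ^^ Suc k) y) < e"
    by (metis diff_zero le_Suc_eq le_refl)
  then have k: "norm ((f ^^ (q * Suc k)) y) < e"
    by (simp only: funpow_mult)
  have small: "(f ^^ (q * Suc k)) y \<in> zero_ball R"
    by (rule sub, rule norm_funpow_le[OF assms(1,2) dec _ y]) auto
  have "norm ((f ^^ n) y) < e" if "n \<ge> q * Suc k + q" for n
  proof -
    have "(f ^^ n) y = (f ^^ (n - q * Suc k)) ((f ^^ (q * Suc k)) y)"
      using that by (metis add_leD1 comp_apply funpow_add le_add_diff_inverse2)
    also have "norm \<dots> \<le> norm ((f ^^ (q * Suc k)) y)"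
      by (rule norm_funpow_le[OF assms(1,2) dec _ small]) (use that in auto)
    finally show ?thesis using k by linarith
  qed
  then show "\<exists>no. \<forall>n\<ge>no. norm ((f ^^ n) y - 0) < e"
    by auto
qed

section \<open>Approximation of the domain of attraction\<close>

theorem theorem3p11:
  fixes \<Omega> :: "(real ^ 'n) set" and f :: "real ^ 'n \<Rightarrow> real ^ 'n"
  assumes "open \<Omega>" and "connected \<Omega>" and "0 \<in> \<Omega>"
    and "f \<in> \<Omega> \<rightarrow> \<Omega>" and "real_analytic_on f \<Omega>" and "f 0 = 0"
    and "matrix_spectral_radius (jacobian f (at 0)) < 1"
  shows "(\<forall>p\<ge>p_tilde f. M_tilde \<Omega> f p \<subseteq> domain_of_attraction \<Omega> f) \<and>
         (\<forall>k. \<forall>p\<in>{p_tilde f..2 * p_tilde f - 1}.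
            M_tilde \<Omega> f (k * p) \<subseteq> M_tilde \<Omega> f ((k + 1) * p)) \<and>
         (\<forall>x\<in>domain_of_attraction \<Omega> f. \<exists>p\<ge>p_tilde f. x \<in> M_tilde \<Omega> f p)"
proof (intro conjI allI impI ballI subsetI)
  have diff: "f differentiable (at a)" if "a \<in> \<Omega>" for a
    by (rule real_analytic_on_imp_differentiable[OF assms(5) that])
  then have "continuous_on \<Omega> f"
    by (intro continuous_at_imp_continuous_on ballI differentiable_imp_continuous_within) auto
  then have cont: "continuous_on \<Omega> (f ^^ k)" for k
    by (rule continuous_on_funpow) fact
  note q = p_tilde_works(1)[OF assms(7)]
  note R = R_tilde_works[OF assms(1,3) diff[OF assms(3)] assms(6,7)]
  note le = norm_funpow_le[OF q assms(6) R(3)]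
  {
    fix p x assume "x \<in> M_tilde \<Omega> f p"
    then have x: "x \<in> \<Omega>" "(f ^^ p) x \<in> zero_ball (R_tilde \<Omega> f)"
      by (auto simp: M_tilde_def)
    have "(\<lambda>n. (f ^^ n) ((f ^^ p) x)) \<longlonglongrightarrow> 0"
      by (rule funpow_tendsto_zero[OF q assms(6) continuous_on_subset[OF cont R(2)] R(3) x(2)])
    then have "(\<lambda>n. (f ^^ (n + p)) x) \<longlonglongrightarrow> 0"
      by (simp add: funpow_add)
    then show "x \<in> domain_of_attraction \<Omega> f"
      using LIMSEQ_offset x(1) by (auto simp: domain_of_attraction_def)
  next
    fix k p x assume p: "p \<in> {p_tilde f..2 * p_tilde f - 1}" and "x \<in> M_tilde \<Omega> f (k * p)"
    then have x: "x \<in> \<Omega>" "(f ^^ (k * p)) x \<in> zero_ball (R_tilde \<Omega> f)"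
      by (auto simp: M_tilde_def)
    have "(f ^^ p) ((f ^^ (k * p)) x) \<in> zero_ball (R_tilde \<Omega> f)"
      by (rule zero_ball_mono_norm[OF x(2)], rule le[OF _ x(2)]) (use p in auto)
    then show "x \<in> M_tilde \<Omega> f ((k + 1) * p)"
      using x(1) by (simp add: M_tilde_def funpow_add)
  next
    fix x assume "x \<in> domain_of_attraction \<Omega> f"
    then have x: "x \<in> \<Omega>" "(\<lambda>k. (f ^^ k) x) \<longlonglongrightarrow> 0"
      by (auto simp: domain_of_attraction_def)
    have "(\<lambda>k. ereal (norm ((f ^^ k) x))) \<longlonglongrightarrow> ereal 0"
      using tendsto_norm_zero[OF x(2)] by (intro tendsto_intros)
    then have "\<forall>\<^sub>F k in sequentially. ereal (norm ((f ^^ k) x)) < R_tilde \<Omega> f"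
      using R(1) by (intro order_tendstoD(2)) (auto simp: zero_ereal_def)
    then have "\<forall>\<^sub>F k in sequentially. k \<ge> p_tilde f \<and> x \<in> M_tilde \<Omega> f k"
      using eventually_ge_at_top[of "p_tilde f"]
      by eventually_elim (simp add: M_tilde_def zero_ball_def x(1))
    then show "\<exists>p\<ge>p_tilde f. x \<in> M_tilde \<Omega> f p"
      using eventually_happens'[OF sequentially_bot] by blast
  }
qed

end
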